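(* Let $G=(G_{i,j}(x))$ be an $m\times n$ matrix all of whose entries are $0$, $1$ or $x$. Suppose $G$ has no $2\times 2$ submatrix $\left(\begin{smallmatrix} G_{ki} & G_{kj}\\ G_{li} & G_{lj}\end{smallmatrix}\right)$ (with $k<l$, $i<j$) of any of the following forms: (i) $\left(\begin{smallmatrix} x & G_{kj}\\ 1 & G_{lj}\end{smallmatrix}\right)$ or $\left(\begin{smallmatrix} G_{ki} & x\\ G_{li} & 1\end{smallmatrix}\right)$; (ii) $\left(\begin{smallmatrix} 1 & x\\ G_{li} & G_{lj}\end{smallmatrix}\right)$ or $\left(\begin{smallmatrix} G_{ki} & G_{kj}\\ 1 & x\end{smallmatrix}\right)$; (iii) $\left(\begin{smallmatrix} 1 & G_{kj}\\ G_{li} & x\end{smallmatrix}\right)$, $\left(\begin{smallmatrix} x & G_{kj}\\ G_{li} & 1\end{smallmatrix}\right)$ or $\left(\begin{smallmatrix} G_{ki} & x\\ 1 & G_{lj}\end{smallmatrix}\right)$, except for $\left(\begin{smallmatrix} 1 & 1\\ x & x\end{smallmatrix}\right)$ and $\left(\begin{smallmatrix} x & 1\\ x & 1\end{smallmatrix}\right)$; (iv) all entries are $0$ or $1$ and the determinant is negative; (v) $x$ times a zero-one matrix with negative determinant. Then $G : \mathcal{F}^+_n \rightarrow \mathcal{F}^+_m$.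
   Context: For real-rooted polynomials $f,g\in\mathbb{R}[x]$ with positive leading coefficients and zeros $\alpha_1\ge\cdots\ge\alpha_n$ and $\beta_1\ge\cdots\ge\beta_m$ respectively, write $f\ll g$ if $\cdots\le\alpha_2\le\beta_2\le\alpha_1\le\beta_1$; also $f\ll 0$ and $0\ll f$. A sequence $(f_i)_{i=1}^n$ of real-rooted polynomials is interlacing if $f_i\ll f_j$ for all $1\le i<j\le n$. $\mathcal{F}^+_n$ is the family of interlacing sequences $(f_i)_{i=1}^n$ in which every $f_i$ has nonnegative coefficients. An $m\times n$ matrix $G$ of polynomials acts by $G\cdot(f_1,\dots,f_n)^T=(g_1,\dots,g_m)^T$ with $g_k=\sum_{i=1}^n G_{ki}f_i$, and $G:\mathcal{F}^+_n\to\mathcal{F}^+_m$ means this maps every element of $\mathcal{F}^+_n$ into $\mathcal{F}^+_m$. A known characterization: $G:\mathcal{F}^+_n\to\mathcal{F}^+_m$ iff all coefficients of all $G_{ij}$ are nonnegative and for all $\lambda,\mu>0$, $1\le i<j\le n$, $1\le k<l\le m$: $(\lambda x+\mu)G_{kj}(x)+G_{lj}(x)\ll(\lambda x+\mu)G_{ki}(x)+G_{li}(x)$.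
   Formalization: It is additionally assumed that m = 1 if and only if n = 1: for a single row or column there are no 2×2 submatrices and the claim fails, e.g. G = (1 x) sends (x+2, x+1) to x²+2x+2, which is not real-rooted. *)

theory Defs
  imports
    Complex_Main
    "HOL-Library.Multiset"
    "HOL-Computational_Algebra.Polynomial"
    "Jordan_Normal_Form.Determinant"
begin

(* The zero polynomial counts as real-rooted: it is admitted in interlacing sequences. *)
definition real_rooted :: "real poly \<Rightarrow> bool" where
  "real_rooted f \<longleftrightarrow>
     f = 0 \<or> (\<forall>z :: complex. poly (map_poly complex_of_real f) z = 0 \<longrightarrow> z \<in> \<real>)"

(* Real zeros in weakly decreasing order, repeated according to multiplicity. *)
definition zeros :: "real poly \<Rightarrow> real list" where
  "zeros f = rev (sorted_list_of_multiset (proots f))"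

(* With f having zeros a0 >= a1 >= ... and g having zeros b0 >= b1 >= ..., the chain
   ... <= a1 <= b1 <= a0 <= b0 uses all zeros of f and g, alternately and starting with b0;
   hence g has as many zeros as f or one more. By convention f << 0 and 0 << f
   (so also 0 << 0). *)
definition interlaces :: "real poly \<Rightarrow> real poly \<Rightarrow> bool" (infix \<open>\<lless>\<close> 50) where
  "f \<lless> g \<longleftrightarrow>
     real_rooted f \<and> real_rooted g \<and>
     (f \<noteq> 0 \<longrightarrow> lead_coeff f > 0) \<and> (g \<noteq> 0 \<longrightarrow> lead_coeff g > 0) \<and>
     (f \<noteq> 0 \<longrightarrow> g \<noteq> 0 \<longrightarrow>
        (length (zeros g) = length (zeros f) \<or> length (zeros g) = length (zeros f) + 1) \<and>
        (\<forall>i < length (zeros f). zeros f ! i \<le> zeros g ! i) \<and>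
        (\<forall>i < length (zeros f). i + 1 < length (zeros g) \<longrightarrow> zeros g ! (i + 1) \<le> zeros f ! i))"

definition interlacing_sequence :: "real poly vec \<Rightarrow> bool" where
  "interlacing_sequence f \<longleftrightarrow>
     (\<forall>i < dim_vec f. real_rooted (f $ i)) \<and>
     (\<forall>i j. i < j \<longrightarrow> j < dim_vec f \<longrightarrow> f $ i \<lless> f $ j)"

definition F_plus :: "nat \<Rightarrow> real poly vec set" where
  "F_plus n = {f \<in> carrier_vec n. interlacing_sequence f \<and>
                 (\<forall>i < n. \<forall>k. coeff (f $ i) k \<ge> 0)}"

abbreviation X :: "real poly" where
  "X \<equiv> [:0, 1:]"

definition submatrix2 :: "'a mat \<Rightarrow> nat \<Rightarrow> nat \<Rightarrow> nat \<Rightarrow> nat \<Rightarrow> 'a mat" where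
  "submatrix2 G k l i j =
     mat_of_rows_list 2 [[G $$ (k, i), G $$ (k, j)],
                         [G $$ (l, i), G $$ (l, j)]]"

definition zero_one_neg_det :: "real mat \<Rightarrow> bool" where
  "zero_one_neg_det B \<longleftrightarrow>
     B \<in> carrier_mat 2 2 \<and> elements_mat B \<subseteq> {0, 1} \<and> det B < 0"

definition forbidden_i :: "real poly mat \<Rightarrow> bool" where
  "forbidden_i M \<longleftrightarrow>
     (M $$ (0, 0) = X \<and> M $$ (1, 0) = 1) \<or>
     (M $$ (0, 1) = X \<and> M $$ (1, 1) = 1)"

definition forbidden_ii :: "real poly mat \<Rightarrow> bool" where
  "forbidden_ii M \<longleftrightarrow>
     (M $$ (0, 0) = 1 \<and> M $$ (0, 1) = X) \<or>
     (M $$ (1, 0) = 1 \<and> M $$ (1, 1) = X)"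

definition forbidden_iii :: "real poly mat \<Rightarrow> bool" where
  "forbidden_iii M \<longleftrightarrow>
     ((M $$ (0, 0) = 1 \<and> M $$ (1, 1) = X) \<or>
      (M $$ (0, 0) = X \<and> M $$ (1, 1) = 1) \<or>
      (M $$ (0, 1) = X \<and> M $$ (1, 0) = 1)) \<and>
     M \<noteq> mat_of_rows_list 2 [[1, 1], [X, X]] \<and>
     M \<noteq> mat_of_rows_list 2 [[X, 1], [X, 1]]"

definition forbidden_iv :: "real poly mat \<Rightarrow> bool" where
  "forbidden_iv M \<longleftrightarrow> (\<exists>B. zero_one_neg_det B \<and> M = map_mat (\<lambda>c. [:c:]) B)"

definition forbidden_v :: "real poly mat \<Rightarrow> bool" where
  "forbidden_v M \<longleftrightarrow> (\<exists>B. zero_one_neg_det B \<and> M = X \<cdot>\<^sub>m map_mat (\<lambda>c. [:c:]) B)"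

definition forbidden :: "real poly mat \<Rightarrow> bool" where
  "forbidden M \<longleftrightarrow>
     forbidden_i M \<or> forbidden_ii M \<or> forbidden_iii M \<or> forbidden_iv M \<or> forbidden_v M"

end

theory Submission
  imports Defs "HOL-Computational_Algebra.Fundamental_Theorem_Algebra"
begin

text \<open>For real-rooted \<open>f\<close> and \<open>g\<close>, \<open>f \<lless> g\<close> holds iff for every \<open>t\<close> the number of zeros of \<open>g\<close> in
  \<open>[t, \<infinity>)\<close> exceeds that of \<open>f\<close> by \<open>0\<close> or \<open>1\<close>. In this form common zeros cancel, and for
  nonnegative coefficients \<open>f \<lless> g\<close> is equivalent to \<open>g \<lless> X * f\<close>. The set of \<open>g\<close> with \<open>f \<lless> g\<close> is closed
  under addition: after cancelling common zeros, the sign pattern of \<open>g + h\<close> at the zeros of \<open>f\<close>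
  alternates, which locates the zeros of \<open>g + h\<close>. Hence sums of polynomials interlace as soon as all
  pairs of summands do, and instead of the general characterization it suffices to check
  \<open>G\<^sub>k\<^sub>i * f\<^sub>i \<lless> G\<^sub>l\<^sub>j * f\<^sub>j\<close> for two rows \<open>k < l\<close>, apart from two groups of columns whose
  partial sums are compared directly.\<close>

section \<open>Real-rooted polynomials and zero counting\<close>

lemma poly_complex_linear_mult:
  "poly (map_poly complex_of_real ([:-a, 1:] * f)) z = (z - of_real a) * poly (map_poly of_real f) z"
proof -
  have "map_poly complex_of_real ([:-a, 1:] * f) = [:- of_real a, 1:] * map_poly of_real f"
    by (intro poly_eqI) (simp add: coeff_map_poly coeff_pCons split: nat.split)
  then show ?thesis
    by (simp only: poly_mult) simp
qed

lemma real_rooted_linear_mult: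
  assumes "f \<noteq> 0"
  shows "real_rooted ([:-a, 1:] * f) \<longleftrightarrow> real_rooted f"
proof -
  have "[:-a, 1:] * f \<noteq> 0"
    using assms by (simp only: mult_eq_0_iff) simp
  then show ?thesis
    unfolding real_rooted_def poly_complex_linear_mult using assms by auto
qed

lemma real_rooted_0 [simp]: "real_rooted 0"
  by (simp add: real_rooted_def)

lemma real_rooted_const: "real_rooted [:c:]"
  by (simp add: real_rooted_def map_poly_pCons)

text \<open>The fundamental theorem of algebra supplies a complex zero, and real-rootedness forces
  it to be real.\<close>

lemma real_rooted_obtain_root:
  assumes "real_rooted f" "degree f > 0"
  obtains a where "poly f a = 0"
proof -
  let ?F = "map_poly complex_of_real f"
  have "\<not> constant (poly ?F)"
    using assms(2) by (simp add: constant_degree degree_map_poly)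
  then obtain z where z: "poly ?F z = 0"
    using fundamental_theorem_of_algebra by blast
  then have "z \<in> \<real>"
    using assms unfolding real_rooted_def by auto
  then obtain a where a: "z = of_real a"
    by (auto elim: Reals_cases)
  have "poly ?F (of_real a) = of_real (poly f a)"
    by (induction f) (simp_all add: map_poly_pCons)
  then show thesis
    using z a that by simp
qed

lemma obtain_linear_factor:
  assumes "poly f a = 0" "f \<noteq> (0 :: real poly)"
  obtains g where "f = [:-a, 1:] * g" "g \<noteq> 0" "degree f = Suc (degree g)" "lead_coeff f = lead_coeff g"
proof -
  obtain g where g: "f = [:-a, 1:] * g"
    using assms(1) by (auto simp: poly_eq_0_iff_dvd elim: dvdE)
  moreover have "g \<noteq> 0"
    using g assms(2) by auto
  moreover have "degree f = Suc (degree g)"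
    unfolding g using \<open>g \<noteq> 0\<close> by (subst degree_mult_eq) auto
  moreover have "lead_coeff f = lead_coeff g"
    unfolding g by (subst lead_coeff_mult) simp
  ultimately show thesis
    using that by blast
qed

text \<open>Splitting off one real zero leaves a real-rooted quotient of smaller degree, so every
  nonzero real-rooted polynomial is built from a constant by linear factors.\<close>

lemma real_rooted_induct [consumes 2, case_names const linear]:
  assumes "real_rooted f" "f \<noteq> 0"
    and const: "\<And>c. c \<noteq> 0 \<Longrightarrow> P [:c:]"
    and linear: "\<And>a g. real_rooted g \<Longrightarrow> g \<noteq> 0 \<Longrightarrow> P g \<Longrightarrow> P ([:-a, 1:] * g)"
  shows "P f"
  using assms(1,2)
proof (induction "degree f" arbitrary: f)
  case 0
  then show ?case
    using const by (metis degree_eq_zeroE pCons_0_0)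
next
  case (Suc d)
  obtain a where a: "poly f a = 0"
    using real_rooted_obtain_root[of f] Suc by auto
  obtain g where g: "f = [:-a, 1:] * g" "g \<noteq> 0" "degree f = Suc (degree g)"
    using obtain_linear_factor[OF a] Suc by metis
  then have "real_rooted g"
    using Suc.prems real_rooted_linear_mult[of g a] by simp
  then show ?case
    using linear[of g a] g Suc by simp
qed

section \<open>Counting zeros in closed right half-lines\<close>

definition zeros_ge :: "real poly \<Rightarrow> real \<Rightarrow> nat" where
  "zeros_ge f t = size {#x \<in># proots f. t \<le> x#}"

lemma zeros_ge_const [simp]: "zeros_ge [:c:] t = 0"
  by (simp add: zeros_ge_def)

lemma proots_linear_mult:
  assumes "f \<noteq> 0"
  shows "proots ([:-a, 1:] * f) = add_mset a (proots f)"
proof -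
  have "proots ([:-a, 1:] * f) = proots [:-a, 1:] + proots f"
    using assms by (intro proots_mult) simp_all
  then show ?thesis
    by (simp only: proots_linear_factor) simp
qed

lemma zeros_ge_linear_mult:
  assumes "f \<noteq> 0"
  shows "zeros_ge ([:-a, 1:] * f) t = zeros_ge f t + of_bool (t \<le> a)"
  unfolding zeros_ge_def proots_linear_mult[OF assms] by simp

lemma zeros_ge_X_mult:
  assumes "f \<noteq> 0"
  shows "zeros_ge (X * f) t = zeros_ge f t + of_bool (t \<le> 0)"
  using zeros_ge_linear_mult[OF assms, of 0 t] by simp

lemma zeros_ge_antimono: "s \<le> t \<Longrightarrow> zeros_ge f t \<le> zeros_ge f s"
  unfolding zeros_ge_def by (intro size_mset_mono filter_mset_mono_strong) auto

lemma zeros_ge_le_degree: "zeros_ge f t \<le> degree f"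
  unfolding zeros_ge_def
  using size_proots_le[of f] size_filter_mset_lesseq le_trans by blast

lemma size_proots_real_rooted:
  assumes "real_rooted f" "f \<noteq> 0"
  shows "size (proots f) = degree f"
  using assms
proof (induction rule: real_rooted_induct)
  case (linear a g)
  then have "degree ([:-a, 1:] * g) = Suc (degree g)"
    by (subst degree_mult_eq) auto
  then show ?case
    using linear by (simp only: proots_linear_mult[OF linear(2)]) simp
qed simp

lemma zeros_ge_eq_size_below:
  "\<exists>t0. \<forall>t \<le> t0. zeros_ge f t = size (proots f)"
proof -
  obtain t0 where t0: "\<forall>x \<in> set_mset (proots f). t0 \<le> x"
    using bdd_below_finite[OF finite_set_mset] unfolding bdd_below_def by blast
  have "{#x \<in># proots f. t \<le> x#} = proots f" if "t \<le> t0" for t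
    using t0 that by (auto simp: filter_mset_eq_conv)
  then show ?thesis
    unfolding zeros_ge_def by (intro exI[of _ t0]) simp
qed

text \<open>The linear factors negative at \<open>t\<close> are those whose zero lies to the right
  of \<open>t\<close>. Since \<open>t\<close> is no zero itself, these are the zeros that
  \<open>zeros_ge\<close> counts.\<close>

lemma sgn_poly_eq_zeros_ge:
  assumes "real_rooted f" "f \<noteq> 0" "poly f t \<noteq> 0"
  shows "sgn (poly f t) = sgn (lead_coeff f) * (-1) ^ zeros_ge f t"
  using assms
proof (induction rule: real_rooted_induct)
  case (const c)
  then show ?case by simp
next
  case (linear a g)
  have lc: "lead_coeff ([:-a, 1:] * g) = lead_coeff g"
    by (subst lead_coeff_mult) simp
  have p: "poly ([:-a, 1:] * g) t = (t - a) * poly g t"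
    by (simp add: algebra_simps)
  have t: "t \<noteq> a" "poly g t \<noteq> 0"
    using linear.prems unfolding p by auto
  show ?case
    unfolding lc zeros_ge_linear_mult[OF linear(2)] p sgn_mult linear.IH[OF t(2)]
    using t(1) by (auto simp: sgn_if power_add)
qed

text \<open>Describes the jump of the counting function at \<open>a\<close>; \<open>t\<close> is
  chosen so that no zero lies strictly between \<open>a\<close> and \<open>t\<close>.\<close>

lemma zeros_ge_eq_order_add:
  assumes "f \<noteq> 0" "a < t" "\<And>x. poly f x = 0 \<Longrightarrow> a < x \<Longrightarrow> t \<le> x"
  shows "zeros_ge f a = order a f + zeros_ge f t"
proof -
  have "{#x \<in># proots f. a \<le> x#} = {#x \<in># proots f. x = a#} + {#x \<in># proots f. t \<le> x#}"
    using assms by (intro multiset_eqI) (force simp: order_root)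
  moreover have "size {#x \<in># proots f. x = a#} = order a f"
    using assms(1) by (simp add: filter_eq_replicate_mset)
  ultimately show ?thesis
    unfolding zeros_ge_def by simp
qed

text \<open>The list is decreasing, so the zeros at or above \<open>t\<close> form an initial
  segment of length \<open>zeros_ge f t\<close>. This translates between indices (starting at 0) and
  counts.\<close>

lemma nth_zeros_ge_iff:
  assumes "i < length (zeros f)"
  shows "t \<le> zeros f ! i \<longleftrightarrow> i < zeros_ge f t"
proof -
  let ?xs = "zeros f"
  have srt: "sorted_wrt (\<ge>) ?xs"
    by (simp add: zeros_def sorted_wrt_rev)
  have N: "zeros_ge f t = card {j. j < length ?xs \<and> t \<le> ?xs ! j}"
  proof -
    have "zeros_ge f t = size (filter_mset (\<lambda>x. t \<le> x) (mset ?xs))"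
      by (simp add: zeros_ge_def zeros_def)
    also have "\<dots> = length (filter (\<lambda>x. t \<le> x) ?xs)"
      by (metis mset_filter size_mset)
    finally show ?thesis
      by (simp add: length_filter_conv_card)
  qed
  show ?thesis
  proof
    assume t: "t \<le> ?xs ! i"
    have "{..i} \<subseteq> {j. j < length ?xs \<and> t \<le> ?xs ! j}"
    proof
      fix j assume "j \<in> {..i}"
      then have "?xs ! i \<le> ?xs ! j" "j < length ?xs"
        using srt assms unfolding sorted_wrt_iff_nth_less by (cases "j = i"; force)+
      then show "j \<in> {j. j < length ?xs \<and> t \<le> ?xs ! j}"
        using t by auto
    qed
    then have "card {..i} \<le> zeros_ge f t"
      unfolding N by (intro card_mono) auto
    then show "i < zeros_ge f t" by simp
  next
    assume i: "i < zeros_ge f t"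
    show "t \<le> ?xs ! i"
    proof (rule ccontr)
      assume t: "\<not> t \<le> ?xs ! i"
      have "{j. j < length ?xs \<and> t \<le> ?xs ! j} \<subseteq> {..<i}"
      proof
        fix j assume j: "j \<in> {j. j < length ?xs \<and> t \<le> ?xs ! j}"
        then have "\<not> i < j" "i \<noteq> j"
          using srt t unfolding sorted_wrt_iff_nth_less by force+
        then show "j \<in> {..<i}" by auto
      qed
      from card_mono[OF finite_lessThan this] have "zeros_ge f t \<le> i"
        unfolding N by simp
      then show False using i by simp
    qed
  qed
qed

lemma length_zeros: "length (zeros f) = size (proots f)"
  unfolding zeros_def by (metis length_rev mset_sorted_list_of_multiset size_mset)

lemma interlaces_iff_zeros_ge:
  assumes "f \<noteq> 0" "g \<noteq> 0"
  shows "f \<lless> g \<longleftrightarrow> real_rooted f \<and> real_rooted g \<and> lead_coeff f > 0 \<and> lead_coeff g > 0 \<and>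
    (\<forall>t. zeros_ge f t \<le> zeros_ge g t \<and> zeros_ge g t \<le> zeros_ge f t + 1)"
proof -
  let ?a = "zeros f" and ?b = "zeros g"
  have le: "zeros_ge h t \<le> length (zeros h)" for h t
    unfolding zeros_ge_def length_zeros by (rule size_filter_mset_lesseq)
  have "((length ?b = length ?a \<or> length ?b = length ?a + 1) \<and>
      (\<forall>i < length ?a. ?a ! i \<le> ?b ! i) \<and>
      (\<forall>i < length ?a. i + 1 < length ?b \<longrightarrow> ?b ! (i + 1) \<le> ?a ! i)) \<longleftrightarrow>
    (\<forall>t. zeros_ge f t \<le> zeros_ge g t \<and> zeros_ge g t \<le> zeros_ge f t + 1)" (is "?L \<longleftrightarrow> ?R")
  proof
    assume L: ?L
    show ?R
    proof (intro allI conjI)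
      fix t
      show "zeros_ge f t \<le> zeros_ge g t"
      proof (rule ccontr)
        \<comment> \<open>The index just past the zeros of \<open>g\<close> that are at or above
          \<open>t\<close>.\<close>
        let ?i = "zeros_ge g t"
        assume "\<not> ?thesis"
        then have i: "?i < zeros_ge f t" by simp
        then have a: "?i < length ?a" using le[of f t] by linarith
        then have b: "?i < length ?b" using L by auto
        have "t \<le> ?a ! ?i"
          using i by (simp only: nth_zeros_ge_iff[OF a])
        also have "\<dots> \<le> ?b ! ?i"
          using L a by blast
        finally have "?i < ?i"
          by (simp only: nth_zeros_ge_iff[OF b])
        then show False by simp
      qed
      show "zeros_ge g t \<le> zeros_ge f t + 1"
      proof (rule ccontr)
        let ?i = "zeros_ge f t"
        assume "\<not> ?thesis"
        then have i: "?i + 1 < zeros_ge g t" by simp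
        then have b: "?i + 1 < length ?b" using le[of g t] by linarith
        then have a: "?i < length ?a" using L by auto
        have "t \<le> ?b ! (?i + 1)"
          using i by (simp only: nth_zeros_ge_iff[OF b])
        also have "\<dots> \<le> ?a ! ?i"
          using L a b by blast
        finally have "?i < ?i"
          by (simp only: nth_zeros_ge_iff[OF a])
        then show False by simp
      qed
    qed
  next
    assume R: ?R
    \<comment> \<open>Far enough to the left the counts are the total numbers of zeros, which yields
      the condition on the lengths.\<close>
    obtain s t where "\<forall>r \<le> s. zeros_ge f r = size (proots f)" "\<forall>r \<le> t. zeros_ge g r = size (proots g)"
      using zeros_ge_eq_size_below by metis
    then have "zeros_ge f (min s t) = length ?a" "zeros_ge g (min s t) = length ?b"
      by (simp_all add: length_zeros)
    then have "length ?a \<le> length ?b" "length ?b \<le> length ?a + 1"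
      using R by metis+
    then have len: "length ?b = length ?a \<or> length ?b = length ?a + 1"
      by linarith
    moreover have "?a ! i \<le> ?b ! i" if a: "i < length ?a" for i
    proof -
      have b: "i < length ?b"
        using a len by auto
      have "i < zeros_ge f (?a ! i)"
        by (simp only: nth_zeros_ge_iff[OF a, symmetric])
      also have "\<dots> \<le> zeros_ge g (?a ! i)"
        using R by blast
      finally show ?thesis
        by (simp only: nth_zeros_ge_iff[OF b])
    qed
    moreover have "?b ! (i + 1) \<le> ?a ! i" if "i < length ?a" "i + 1 < length ?b" for i
    proof -
      have "i + 1 < zeros_ge g (?b ! (i + 1))"
        by (simp only: nth_zeros_ge_iff[OF that(2), symmetric])
      also have "\<dots> \<le> zeros_ge f (?b ! (i + 1)) + 1"
        using R by blast
      finally show ?thesis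
        by (simp add: nth_zeros_ge_iff[OF that(1)])
    qed
    ultimately show ?L by blast
  qed
  then show ?thesis
    unfolding interlaces_def using assms by auto
qed

section \<open>Closure of interlacing under addition\<close>

text \<open>A common linear factor adds the same 0 or 1 to both counts, so their difference is
  unchanged.\<close>

lemma interlaces_linear_mult:
  assumes "f \<noteq> 0" "g \<noteq> 0"
  shows "[:-a, 1:] * f \<lless> [:-a, 1:] * g \<longleftrightarrow> f \<lless> g"
proof -
  have nz: "[:-a, 1:] * h \<noteq> 0" if "h \<noteq> 0" for h :: "real poly"
    using that by (simp only: mult_eq_0_iff) simp
  have lc: "lead_coeff ([:-a, 1:] * h) = lead_coeff h" for h :: "real poly"
    by (subst lead_coeff_mult) simp
  show ?thesis
    unfolding interlaces_iff_zeros_ge[OF assms] interlaces_iff_zeros_ge[OF nz[OF assms(1)] nz[OF assms(2)]]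
      real_rooted_linear_mult[OF assms(1)] real_rooted_linear_mult[OF assms(2)] lc
      zeros_ge_linear_mult[OF assms(1)] zeros_ge_linear_mult[OF assms(2)]
    by simp
qed

lemma lead_coeff_pos_add:
  fixes f g :: "real poly"
  assumes "lead_coeff f > 0" "lead_coeff g > 0"
  shows "lead_coeff (f + g) > 0" "degree (f + g) = max (degree f) (degree g)"
proof -
  consider "degree f < degree g" | "degree g < degree f" | "degree f = degree g"
    by linarith
  then have "lead_coeff (f + g) > 0 \<and> degree (f + g) = max (degree f) (degree g)"
  proof cases
    case 1
    then show ?thesis
      using assms by (simp add: degree_add_eq_right coeff_eq_0)
  next
    case 2
    then show ?thesis
      using assms by (simp add: degree_add_eq_left coeff_eq_0)
  next
    case 3
    then have pos: "coeff (f + g) (degree f) > 0"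
      using assms by simp
    moreover have "degree (f + g) = degree f"
    proof (rule antisym)
      show "degree (f + g) \<le> degree f"
        using 3 by (intro degree_add_le) auto
      show "degree f \<le> degree (f + g)"
        using pos by (intro le_degree) simp
    qed
    ultimately show ?thesis
      using 3 by simp
  qed
  then show "lead_coeff (f + g) > 0" "degree (f + g) = max (degree f) (degree g)"
    by auto
qed

lemma degree_interlaces:
  assumes "f \<lless> g" "f \<noteq> 0" "g \<noteq> 0"
  shows "degree g \<in> {degree f, Suc (degree f)}"
  using assms size_proots_real_rooted[of f] size_proots_real_rooted[of g]
  unfolding interlaces_def length_zeros by auto

lemma real_rooted_degree_le_1:
  fixes p :: "real poly"
  assumes "degree p \<le> 1"
  shows "real_rooted p"
proof (cases "degree p = 0")
  case True
  then show ?thesis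
    using real_rooted_const by (auto elim: degree_eq_zeroE)
next
  case False
  then have deg: "degree p = 1"
    using assms by simp
  then have c1: "coeff p 1 \<noteq> 0" and nz: "p \<noteq> 0"
    using leading_coeff_0_iff[of p] by auto
  have "poly p (- coeff p 0 / coeff p 1) = 0"
    using c1 by (simp add: poly_altdef deg)
  then obtain a q where q: "p = [:-a, 1:] * q" "q \<noteq> 0" "degree p = Suc (degree q)"
    using obtain_linear_factor nz by metis
  then have "degree q = 0"
    using deg by simp
  then have "real_rooted q"
    using real_rooted_const by (auto elim: degree_eq_zeroE)
  then show ?thesis
    unfolding q(1) real_rooted_linear_mult[OF q(2)] .
qed

text \<open>Peel off the largest root of \<open>p\<close> and then the largest root of \<open>f\<close>: the quotients satisfy
  the hypotheses again, with \<open>f\<close> one degree smaller.\<close>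
lemma interlaces_if_alternating_signs:
  assumes "real_rooted f" "lead_coeff f > 0" "lead_coeff p > 0"
    and "degree p \<in> {degree f, Suc (degree f)}"
    and "\<And>a. poly f a = 0 \<Longrightarrow> order a f = 1"
    and "\<And>a. poly f a = 0 \<Longrightarrow> (-1) ^ zeros_ge f a * poly p a > 0"
  shows "f \<lless> p"
  using assms
proof (induction "degree f" arbitrary: f p)
  case 0
  have nz: "f \<noteq> 0" "p \<noteq> 0"
    using 0 by auto
  have "zeros_ge f t = 0" "zeros_ge p t \<le> 1" for t
    using 0 zeros_ge_le_degree[of f t] zeros_ge_le_degree[of p t] by auto
  then show ?case
    unfolding interlaces_iff_zeros_ge[OF nz] using 0 real_rooted_degree_le_1[of p] by auto
next
  case (Suc d)
  have nz: "f \<noteq> 0" "p \<noteq> 0"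
    using Suc by auto
  define A where "A = {x. poly f x = 0}"
  define a where "a = Max A"
  have "degree f > 0"
    using Suc.hyps(2) by simp
  then obtain x0 where "poly f x0 = 0"
    using real_rooted_obtain_root[OF Suc.prems(1)] by blast
  then have fin: "finite A" and "A \<noteq> {}"
    unfolding A_def using poly_roots_finite[OF nz(1)] by auto
  then have "a \<in> A"
    unfolding a_def by (rule Max_in)
  then have root: "poly f a = 0"
    unfolding A_def by simp
  have top: "x \<le> a" if "poly f x = 0" for x
    unfolding a_def using fin that by (intro Max_ge) (auto simp: A_def)
  \<comment> \<open>The largest zero \<open>a\<close> is simple, so exactly one zero of
    \<open>f\<close> is counted there and the sign hypothesis makes \<open>p\<close> negative at
    \<open>a\<close>.\<close>
  have "zeros_ge f (a + 1) = 0"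
    unfolding zeros_ge_def using nz top by (force simp: filter_mset_eq_mempty_iff)
  then have "zeros_ge f a = 1"
    using zeros_ge_eq_order_add[OF nz(1), of a "a + 1"] Suc.prems(5)[OF root] top by fastforce
  then have pa: "poly p a < 0"
    using Suc.prems(6)[OF root] by simp
  \<comment> \<open>As \<open>p\<close> is negative at \<open>a\<close> and positive far to the
    right, it has a zero \<open>b\<close> beyond \<open>a\<close>.\<close>
  obtain M where M: "\<And>x. x \<ge> M \<Longrightarrow> poly p x > 0"
    using poly_pinfty_gt_lc[OF Suc.prems(3)] Suc.prems(3) by force
  obtain b where b: "a < b" "poly p b = 0"
    using poly_IVT_pos[of a "max M (a + 1)" p] pa M[of "max M (a + 1)"] by force
  obtain g where g: "f = [:-a, 1:] * g" "g \<noteq> 0" "degree f = Suc (degree g)" "lead_coeff f = lead_coeff g"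
    using obtain_linear_factor[OF root nz(1)] by metis
  obtain q where q: "p = [:-b, 1:] * q" "q \<noteq> 0" "degree p = Suc (degree q)" "lead_coeff p = lead_coeff q"
    using obtain_linear_factor[OF b(2) nz(2)] by metis
  have Nf: "zeros_ge f t = zeros_ge g t + of_bool (t \<le> a)" for t
    using zeros_ge_linear_mult[OF g(2), of a t] g(1) by simp
  have Np: "zeros_ge p t = zeros_ge q t + of_bool (t \<le> b)" for t
    using zeros_ge_linear_mult[OF q(2), of b t] q(1) by simp
  have poly_f: "poly f t = (t - a) * poly g t" and poly_p: "poly p t = (t - b) * poly q t" for t
    by (subst g(1) q(1), simp add: algebra_simps)+
  have ord_g: "order c g = 1" and c_less: "c < a" if "poly g c = 0" for c
  proof -
    have "poly f c = 0" using that by (simp add: poly_f)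
    then have 1: "order c f = 1" and ca: "c \<le> a"
      using Suc.prems(5) top by auto
    have eq: "order c f = order c [:-a, 1:] + order c g"
      using order_mult[of "[:-a, 1:]" g c] nz g(1) by simp
    have g0: "order c g \<noteq> 0"
      using that g(2) by (simp add: order_root)
    show "order c g = 1" using 1 eq g0 by linarith
    have "order c [:-a, 1:] = 0" using 1 eq g0 by linarith
    then have "c \<noteq> a"
      using order_root[of "[:-a, 1:]" c] by auto
    with ca show "c < a" by simp
  qed
  have "real_rooted g"
    using Suc.prems(1) g(1) real_rooted_linear_mult[OF g(2)] by metis
  \<comment> \<open>At a zero \<open>c < a < b\<close>, dropping \<open>a\<close> lowers the count
    by one and dropping the factor \<open>c - b < 0\<close> flips the sign; the two changes
    cancel.\<close>
  moreover have "(-1) ^ zeros_ge g c * poly q c > 0" if "poly g c = 0" for c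
  proof -
    have "poly f c = 0" "c < a"
      using that c_less by (simp_all add: poly_f)
    then have "(-1) ^ zeros_ge g c * (b - c) * poly q c > 0"
      using Suc.prems(6)[of c] by (simp add: Nf poly_p algebra_simps)
    moreover have "b - c > 0"
      using \<open>c < a\<close> b by simp
    ultimately show ?thesis
      by (metis mult.assoc mult.commute zero_less_mult_pos)
  qed
  ultimately have gq: "g \<lless> q"
    using Suc.hyps(1)[of g q] Suc.hyps(2) Suc.prems(2-4) g q ord_g by auto
  have inter: "real_rooted q" "\<And>t. zeros_ge g t \<le> zeros_ge q t" "\<And>t. zeros_ge q t \<le> zeros_ge g t + 1"
    using gq unfolding interlaces_iff_zeros_ge[OF g(2) q(2)] by auto
  have qa: "poly q a > 0"
    using pa b(1) unfolding poly_p by (simp add: mult_less_0_iff)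
  \<comment> \<open>So far \<open>b\<close> was just some zero beyond \<open>a\<close>. The count is
    at most 1, and positivity of \<open>q\<close> at \<open>a\<close> makes it even. Hence
    \<open>b\<close> is the only zero of \<open>p\<close> at or beyond \<open>a\<close>.\<close>
  have "zeros_ge q a = 0"
  proof -
    have "zeros_ge q a \<le> 1"
      using inter(3)[of a] \<open>zeros_ge f a = 1\<close> by (simp add: Nf)
    moreover have "zeros_ge q a \<noteq> 1"
      using sgn_poly_eq_zeros_ge[OF inter(1) q(2), of a] qa Suc.prems(3) q(4) by auto
    ultimately show ?thesis by linarith
  qed
  then have q0: "zeros_ge q t = 0" if "a \<le> t" for t
    using zeros_ge_antimono[OF that, of q] by simp
  have "zeros_ge f t \<le> zeros_ge p t \<and> zeros_ge p t \<le> zeros_ge f t + 1" for t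
    using inter(2,3)[of t] q0[of t] b(1) unfolding Nf Np by (cases "t \<le> a") auto
  moreover have "real_rooted p"
    using inter(1) q(1) real_rooted_linear_mult[OF q(2)] by metis
  ultimately show ?case
    unfolding interlaces_iff_zeros_ge[OF nz] using Suc.prems by simp
qed

text \<open>At a zero of \<open>f\<close> the sign of an interlacing \<open>g\<close> is determined by \<open>f\<close> alone.\<close>
lemma zeros_ge_interlaces_at_zero:
  assumes "f \<lless> g" "f \<noteq> 0" "g \<noteq> 0" "poly f a = 0" "poly g a \<noteq> 0"
  shows "zeros_ge g a = zeros_ge f a" "order a f = 1"
proof -
  have le: "zeros_ge f t \<le> zeros_ge g t" "zeros_ge g t \<le> zeros_ge f t + 1" for t
    using assms(1) unfolding interlaces_iff_zeros_ge[OF assms(2,3)] by auto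
  \<comment> \<open>Choose \<open>t > a\<close> with no zero of \<open>f\<close> or \<open>g\<close>
    strictly between; \<open>a + 1\<close> keeps \<open>A\<close> nonempty. From \<open>t\<close> to
    \<open>a\<close> the count of \<open>f\<close> grows by its order at \<open>a\<close> and that
    of \<open>g\<close> not at all, so the bounds at both points leave only order 1 and equal counts
    at \<open>a\<close>.\<close>
  define A where "A = insert (a + 1) {x. poly f x = 0 \<and> a < x} \<union> {x. poly g x = 0 \<and> a < x}"
  have fin: "finite A" "A \<noteq> {}"
    unfolding A_def using poly_roots_finite[OF assms(2)] poly_roots_finite[OF assms(3)] by simp_all
  define t where "t = Min A"
  have "t \<in> A"
    unfolding t_def using Min_in[OF fin] .
  then have "a < t" unfolding A_def by auto
  have t: "t \<le> x" if "poly f x = 0 \<or> poly g x = 0" "a < x" for x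
    unfolding t_def using fin that by (intro Min_le) (auto simp: A_def)
  have "zeros_ge f a = order a f + zeros_ge f t" "zeros_ge g a = order a g + zeros_ge g t"
    using zeros_ge_eq_order_add \<open>a < t\<close> t assms by metis+
  moreover have "order a g = 0" "order a f \<noteq> 0"
    using assms by (simp_all add: order_root)
  ultimately show "zeros_ge g a = zeros_ge f a" "order a f = 1"
    using le[of a] le[of t] by linarith+
qed

lemma sign_interlaces_at_zero:
  assumes "f \<lless> g" "f \<noteq> 0" "g \<noteq> 0" "poly f a = 0"
  shows "poly g a = 0 \<or> (-1) ^ zeros_ge f a * poly g a > 0"
proof (cases "poly g a = 0")
  case False
  have "real_rooted g" "lead_coeff g > 0"
    using assms unfolding interlaces_def by auto
  then have "sgn (poly g a) = (-1) ^ zeros_ge f a"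
    using sgn_poly_eq_zeros_ge[OF _ assms(3) False] zeros_ge_interlaces_at_zero(1)[OF assms False] by simp
  then have "(-1) ^ zeros_ge f a * poly g a = \<bar>poly g a\<bar>"
    by (metis abs_sgn mult.commute)
  then show ?thesis using False by simp
qed simp

text \<open>At a zero of \<open>f\<close> the nonzero ones among the values of \<open>g\<close> and
  \<open>h\<close> have the same sign. If \<open>g + h\<close> vanishes there, so do both summands,
  and the common factor is cancelled by induction on the degree. If this never happens, the signs of
  \<open>g + h\<close> alternate strictly.\<close>

lemma interlaces_add_right:
  assumes "f \<lless> g" "f \<lless> h" "f \<noteq> 0" "g \<noteq> 0" "h \<noteq> 0"
  shows "f \<lless> g + h"
  using assms
proof (induction "degree f" arbitrary: f g h rule: less_induct)
  case less
  note fgh = less.prems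
  have lc: "lead_coeff f > 0" "lead_coeff g > 0" "lead_coeff h > 0" "real_rooted f"
    using fgh unfolding interlaces_def by auto
  note p = lead_coeff_pos_add[OF lc(2,3)]
  have sign: "poly g a = 0 \<or> (-1) ^ zeros_ge f a * poly g a > 0"
    "poly h a = 0 \<or> (-1) ^ zeros_ge f a * poly h a > 0" if "poly f a = 0" for a
    using sign_interlaces_at_zero that fgh by metis+
  show ?case
  proof (cases "\<exists>a. poly f a = 0 \<and> poly (g + h) a = 0")
    case True
    then obtain a where a: "poly f a = 0" "poly g a + poly h a = 0"
      by auto
    have "(-1) ^ zeros_ge f a * poly g a + (-1) ^ zeros_ge f a * poly h a = 0"
      using a(2) by (simp flip: distrib_left)
    then have a': "poly g a = 0" "poly h a = 0"
      using sign[OF a(1)] a(2) by auto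
    obtain f' where f': "f = [:-a, 1:] * f'" "f' \<noteq> 0" "degree f = Suc (degree f')"
      using obtain_linear_factor[OF a(1) fgh(3)] by metis
    obtain g' where g': "g = [:-a, 1:] * g'" "g' \<noteq> 0"
      using obtain_linear_factor[OF a'(1) fgh(4)] by metis
    obtain h' where h': "h = [:-a, 1:] * h'" "h' \<noteq> 0"
      using obtain_linear_factor[OF a'(2) fgh(5)] by metis
    have "f' \<lless> g'" "f' \<lless> h'"
      using fgh(1,2) interlaces_linear_mult f' g' h' by metis+
    then have "f' \<lless> g' + h'"
      using less.hyps f' g' h' by simp
    moreover have gh: "g + h = [:-a, 1:] * (g' + h')"
      unfolding g'(1) h'(1) by (rule distrib_left[symmetric])
    moreover have "g' + h' \<noteq> 0"
    proof
      assume "g' + h' = 0"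
      then have "g + h = 0"
        by (simp only: gh mult_zero_right)
      then show False using p(1) by simp
    qed
    ultimately show ?thesis
      using interlaces_linear_mult[OF f'(2)] f'(1) by metis
  next
    case False
    show ?thesis
    proof (rule interlaces_if_alternating_signs)
      show "real_rooted f" "lead_coeff f > 0" "lead_coeff (g + h) > 0"
        using lc p by auto
      show "degree (g + h) \<in> {degree f, Suc (degree f)}"
        using p(2) degree_interlaces[OF fgh(1,3,4)] degree_interlaces[OF fgh(2,3,5)] by auto
      fix a assume a: "poly f a = 0"
      then have "poly g a + poly h a \<noteq> 0"
        using False by auto
      then show "order a f = 1"
        using zeros_ge_interlaces_at_zero(2) fgh a by (metis add_0)
      show "(-1) ^ zeros_ge f a * poly (g + h) a > 0"
        using sign[OF a] \<open>poly g a + poly h a \<noteq> 0\<close> by (auto simp: distrib_left)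
    qed
  qed
qed

section \<open>Nonnegative coefficients\<close>

definition nonneg_coeffs :: "real poly \<Rightarrow> bool" where
  "nonneg_coeffs f \<longleftrightarrow> (\<forall>k. coeff f k \<ge> 0)"

lemma nonneg_coeffs_lead_coeff: "nonneg_coeffs f \<Longrightarrow> f \<noteq> 0 \<Longrightarrow> lead_coeff f > 0"
  unfolding nonneg_coeffs_def by (metis leading_coeff_0_iff order_le_less)

lemma nonneg_coeffs_0 [simp]: "nonneg_coeffs 0"
  by (simp add: nonneg_coeffs_def)

lemma nonneg_coeffs_X_mult: "nonneg_coeffs f \<Longrightarrow> nonneg_coeffs (X * f)"
  by (simp add: nonneg_coeffs_def coeff_pCons split: nat.split)

lemma nonneg_coeffs_sum: "(\<And>i. i \<in> I \<Longrightarrow> nonneg_coeffs (u i)) \<Longrightarrow> nonneg_coeffs (\<Sum>i\<in>I. u i)"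
  by (simp add: nonneg_coeffs_def coeff_sum sum_nonneg)

lemma nonneg_coeffs_entry_mult:
  assumes "w \<in> {0, 1, X}" "nonneg_coeffs f"
  shows "nonneg_coeffs (w * f)"
  using assms nonneg_coeffs_X_mult[of f] by auto

text \<open>The leading term alone is positive at every positive point, so there are no positive
  zeros.\<close>

lemma zeros_ge_nonneg_coeffs:
  assumes "nonneg_coeffs f" "f \<noteq> 0" "t > 0"
  shows "zeros_ge f t = 0"
proof -
  have "poly f x > 0" if "x > 0" for x
  proof -
    have "poly f x \<ge> coeff f (degree f) * x ^ degree f"
      unfolding poly_altdef using assms(1) that
      by (intro member_le_sum) (auto simp: nonneg_coeffs_def)
    moreover have "coeff f (degree f) * x ^ degree f > 0"
      using nonneg_coeffs_lead_coeff[OF assms(1,2)] that by simp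
    ultimately show ?thesis by linarith
  qed
  then have "poly f x \<noteq> 0" if "t \<le> x" for x
    using that assms(3) by (metis less_irrefl less_le_trans)
  then show ?thesis
    unfolding zeros_ge_def using assms(2) by auto
qed

section \<open>Interlacing with zero, with itself and with multiples of \<open>X\<close>\<close>

lemma interlaces_0_left: "0 \<lless> g \<longleftrightarrow> real_rooted g \<and> (g \<noteq> 0 \<longrightarrow> lead_coeff g > 0)"
  and interlaces_0_right: "g \<lless> 0 \<longleftrightarrow> real_rooted g \<and> (g \<noteq> 0 \<longrightarrow> lead_coeff g > 0)"
  by (auto simp: interlaces_def)

lemma interlaces_refl:
  assumes "real_rooted f" "nonneg_coeffs f"
  shows "f \<lless> f"
  using assms nonneg_coeffs_lead_coeff interlaces_iff_zeros_ge[of f f]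
  by (cases "f = 0") (auto simp: interlaces_0_left)

lemma interlaces_real_rooted:
  assumes "f \<lless> g"
  shows "real_rooted f" "real_rooted g"
  using assms by (auto simp: interlaces_def)

lemma real_rooted_X_mult: "real_rooted (X * f) \<longleftrightarrow> real_rooted f"
  using real_rooted_linear_mult[of f 0] by (cases "f = 0") simp_all

lemma lead_coeff_X_mult: "lead_coeff (X * f) = lead_coeff f"
  by (subst lead_coeff_mult) simp

text \<open>All counts vanish for \<open>t > 0\<close>. For \<open>t \<le> 0\<close> the factor
  \<open>X\<close> adds one zero, so a difference \<open>d\<close> of the counts of \<open>g\<close>
  and \<open>f\<close> becomes \<open>1 - d\<close>, and \<open>d\<close> is 0 or 1 iff
  \<open>1 - d\<close> is.\<close>

lemma interlaces_X_mult_iff: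
  assumes "nonneg_coeffs f" "nonneg_coeffs g"
  shows "g \<lless> X * f \<longleftrightarrow> f \<lless> g"
proof (cases "f = 0 \<or> g = 0")
  case True
  then show ?thesis
    using real_rooted_X_mult[of f] lead_coeff_X_mult[of f]
    by (auto simp: interlaces_0_left interlaces_0_right simp del: mult_pCons_left)
next
  case False
  then have nz: "f \<noteq> 0" "g \<noteq> 0" "X * f \<noteq> 0" by auto
  have iff: "(zeros_ge g t \<le> zeros_ge (X * f) t \<and> zeros_ge (X * f) t \<le> zeros_ge g t + 1) \<longleftrightarrow>
      (zeros_ge f t \<le> zeros_ge g t \<and> zeros_ge g t \<le> zeros_ge f t + 1)" for t
    unfolding zeros_ge_X_mult[OF nz(1)]
    using zeros_ge_nonneg_coeffs[OF assms(1) nz(1), of t] zeros_ge_nonneg_coeffs[OF assms(2) nz(2), of t]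
    by (cases "t > 0") auto
  show ?thesis
    unfolding interlaces_iff_zeros_ge[OF nz(2,3)] interlaces_iff_zeros_ge[OF nz(1,2)] iff
      real_rooted_X_mult lead_coeff_X_mult by blast
qed

text \<open>The preceding equivalence is applied twice, through the intermediate relation
  \<open>g \<lless> X * f\<close>.\<close>

lemma X_mult_interlaces_X_mult:
  assumes "nonneg_coeffs f" "nonneg_coeffs g" "f \<lless> g"
  shows "X * f \<lless> X * g"
  using interlaces_X_mult_iff[OF assms(2) nonneg_coeffs_X_mult[OF assms(1)]]
    interlaces_X_mult_iff[OF assms(1,2)] assms(3) by blast

section \<open>Interlacing of finite sums\<close>

lemma interlaces_sum_right:
  assumes "finite J" "f \<noteq> 0" "f \<lless> 0" "\<And>j. j \<in> J \<Longrightarrow> f \<lless> v j"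
  shows "f \<lless> (\<Sum>j\<in>J. v j)"
  using assms(1,4)
proof (induction J rule: finite_induct)
  case empty
  then show ?case using assms by simp
next
  case (insert j J)
  then have "f \<lless> v j" "f \<lless> sum v J" by simp_all
  then have "f \<lless> v j + sum v J"
    using interlaces_add_right assms(2) by (cases "v j = 0 \<or> sum v J = 0") auto
  then show ?case
    using insert by simp
qed

text \<open>Real-rootedness of the sums has to be assumed only because of the convention
  that the zero polynomial interlaces everything. The passage from \<open>f \<lless> g\<close> to \<open>g \<lless> X * f\<close>
  turns sums on the left into sums on the right.\<close>
lemma interlaces_sum:
  assumes "finite I" "finite J"
    and "\<And>i. i \<in> I \<Longrightarrow> nonneg_coeffs (u i)" "\<And>j. j \<in> J \<Longrightarrow> nonneg_coeffs (v j)"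
    and "\<And>i j. i \<in> I \<Longrightarrow> j \<in> J \<Longrightarrow> u i \<lless> v j"
    and "real_rooted (\<Sum>i\<in>I. u i)" "real_rooted (\<Sum>j\<in>J. v j)"
  shows "(\<Sum>i\<in>I. u i) \<lless> (\<Sum>j\<in>J. v j)"
proof -
  let ?u = "\<Sum>i\<in>I. u i" and ?v = "\<Sum>j\<in>J. v j"
  have nn: "nonneg_coeffs ?u" "nonneg_coeffs ?v"
    using assms(3,4) nonneg_coeffs_sum by auto
  have lc: "?u \<noteq> 0 \<longrightarrow> lead_coeff ?u > 0" "?v \<noteq> 0 \<longrightarrow> lead_coeff ?v > 0"
    using nn nonneg_coeffs_lead_coeff by auto
  show ?thesis
  proof (cases "?u = 0 \<or> ?v = 0")
    case True
    then show ?thesis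
      using lc assms(6,7) by (auto simp: interlaces_0_left interlaces_0_right)
  next
    case False
    have v0: "?v \<lless> 0" "0 \<lless> ?v"
      using lc assms(7) by (auto simp: interlaces_0_left interlaces_0_right)
    \<comment> \<open>Any single index serves: \<open>u i \<lless> v j0\<close> contains the
      real-rootedness and positive leading coefficient behind \<open>u i \<lless> 0\<close>.\<close>
    obtain j0 where j0: "j0 \<in> J"
      using False by (metis empty_iff sum.neutral)
    have "?v \<lless> X * u i" if i: "i \<in> I" for i
    proof -
      have "u i \<lless> ?v"
      proof (cases "u i = 0")
        case True
        then show ?thesis using v0 by simp
      next
        case False
        have "u i \<lless> 0"
          using assms(5)[OF i j0] by (auto simp: interlaces_def)
        then show ?thesis
          using interlaces_sum_right[OF assms(2) False] assms(5)[OF i] by blast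
      qed
      then show ?thesis
        using interlaces_X_mult_iff[OF assms(3)[OF i] nn(2)] by blast
    qed
    then have "?v \<lless> (\<Sum>i\<in>I. X * u i)"
      using False v0 by (intro interlaces_sum_right[OF assms(1)]) auto
    then have "?v \<lless> X * ?u"
      by (simp only: sum_distrib_left)
    then show ?thesis
      using interlaces_X_mult_iff[OF nn] by blast
  qed
qed

text \<open>One nonzero summand that interlaces all summands suffices. Take the first nonzero
  \<open>f r\<close> of weight 1: columns of weight \<open>X\<close> do not come after
  \<open>r\<close>, and there \<open>f j \<lless> f r\<close> means
  \<open>f r \<lless> X * f j\<close>. Without weight 1, the first nonzero summand of weight
  \<open>X\<close> does it.\<close>

lemma real_rooted_row_sum:
  fixes f w :: "nat \<Rightarrow> real poly"
  assumes "finite I"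
    and nn: "\<And>i. i \<in> I \<Longrightarrow> nonneg_coeffs (f i)"
    and rr: "\<And>i. i \<in> I \<Longrightarrow> real_rooted (f i)"
    and il: "\<And>i j. i \<in> I \<Longrightarrow> j \<in> I \<Longrightarrow> i < j \<Longrightarrow> f i \<lless> f j"
    and w: "\<And>i. i \<in> I \<Longrightarrow> w i \<in> {0, 1, X}"
    and no_1_X: "\<And>i j. i \<in> I \<Longrightarrow> j \<in> I \<Longrightarrow> i < j \<Longrightarrow> \<not> (w i = 1 \<and> w j = X)"
  shows "real_rooted (\<Sum>i\<in>I. w i * f i)"
proof -
  have first: "real_rooted (\<Sum>i\<in>I. w i * f i)"
    if "r \<in> I" "w r * f r \<noteq> 0" "\<And>j. j \<in> I \<Longrightarrow> w r * f r \<lless> w j * f j" for r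
  proof -
    have "w r * f r \<lless> 0"
      using that(3)[OF that(1)] by (auto simp: interlaces_def interlaces_0_right)
    from interlaces_sum_right[OF assms(1) that(2) this that(3)] show ?thesis
      by (rule interlaces_real_rooted(2))
  qed
  have zero: "f i \<lless> 0" if "i \<in> I" for i
    using nn rr that nonneg_coeffs_lead_coeff by (simp add: interlaces_0_right)
  have Xzero: "X * f i \<lless> 0" if "i \<in> I" for i
    using zero[OF that] real_rooted_X_mult[of "f i"] lead_coeff_X_mult[of "f i"]
    by (simp add: interlaces_0_right del: mult_pCons_left)
  have le: "f i \<lless> f j" if "i \<in> I" "j \<in> I" "i \<le> j" for i j
    using that il nn rr interlaces_refl by (cases "i = j") auto
  show ?thesis
  proof (cases "\<exists>i\<in>I. w i = 1 \<and> f i \<noteq> 0")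
    case True
    define r where "r = (LEAST i. i \<in> I \<and> w i = 1 \<and> f i \<noteq> 0)"
    have r: "r \<in> I" "w r = 1" "f r \<noteq> 0"
      using True LeastI_ex[of "\<lambda>i. i \<in> I \<and> w i = 1 \<and> f i \<noteq> 0"] unfolding r_def by auto
    have least: "r \<le> j" if "j \<in> I" "w j = 1" "f j \<noteq> 0" for j
      unfolding r_def using that by (intro Least_le) simp
    have "f r \<lless> w j * f j" if j: "j \<in> I" for j
    proof -
      consider "w j * f j = 0" | "w j = 1" "f j \<noteq> 0" | "w j = X"
        using w[OF j] by fastforce
      then show ?thesis
      proof cases
        case 1
        then show ?thesis using zero[OF r(1)] by (simp only:)
      next
        case 2
        then show ?thesis using le[OF r(1) j] least[OF j] by simp
      next
        case 3
        then have "j \<le> r" using no_1_X[OF r(1) j] r(2) by force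
        then show ?thesis
          using le[OF j r(1)] interlaces_X_mult_iff[OF nn[OF j] nn[OF r(1)]] 3 by simp
      qed
    qed
    then show ?thesis
      using first[OF r(1)] r by simp
  next
    case no_1: False
    show ?thesis
    proof (cases "\<exists>i\<in>I. w i = X \<and> f i \<noteq> 0")
      case True
      define r where "r = (LEAST i. i \<in> I \<and> w i = X \<and> f i \<noteq> 0)"
      have r: "r \<in> I" "w r = X" "f r \<noteq> 0"
        using True LeastI_ex[of "\<lambda>i. i \<in> I \<and> w i = X \<and> f i \<noteq> 0"] unfolding r_def by auto
      have least: "r \<le> j" if "j \<in> I" "w j = X" "f j \<noteq> 0" for j
        unfolding r_def using that by (intro Least_le) simp
      have "X * f r \<lless> w j * f j" if j: "j \<in> I" for j
      proof -
        consider "w j * f j = 0" | "w j = X" "f j \<noteq> 0"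
          using w[OF j] no_1 j by fastforce
        then show ?thesis
        proof cases
          case 1
          then show ?thesis using Xzero[OF r(1)] by (simp only:)
        next
          case 2
          then show ?thesis
            using X_mult_interlaces_X_mult[OF nn[OF r(1)] nn[OF j]] le[OF r(1) j] least[OF j] by simp
        qed
      qed
      then show ?thesis
        using first[OF r(1)] r by simp
    next
      case False
      have "w i * f i = 0" if "i \<in> I" for i
        using w[OF that] no_1 False that by auto
      then have "(\<Sum>i\<in>I. w i * f i) = 0"
        by (intro sum.neutral) blast
      then show ?thesis
        by simp
    qed
  qed
qed

text \<open>Termwise interlacing of the two row sums only fails inside the columns \<open>(X, X)\<close>, \<open>(1, 1)\<close>
  and inside the columns \<open>(1, X)\<close>. Sums over the former columns are the same in both rows, and sums over
  the latter differ by the factor \<open>X\<close>, so interlacing holds between the sums over these two groups.\<close>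
lemma two_rows_interlace:
  fixes f a b :: "nat \<Rightarrow> real poly"
  assumes nn: "\<And>i. i < n \<Longrightarrow> nonneg_coeffs (f i)"
    and rr: "\<And>i. i < n \<Longrightarrow> real_rooted (f i)"
    and il: "\<And>i j. i < j \<Longrightarrow> j < n \<Longrightarrow> f i \<lless> f j"
    and a: "\<And>i. i < n \<Longrightarrow> a i \<in> {0, 1, X}"
    and b: "\<And>i. i < n \<Longrightarrow> b i \<in> {0, 1, X}"
    and i: "\<And>i. i < n \<Longrightarrow> \<not> (a i = X \<and> b i = 1)"
    and ii: "\<And>i j. i < j \<Longrightarrow> j < n \<Longrightarrow> \<not> (a i = 1 \<and> a j = X) \<and> \<not> (b i = 1 \<and> b j = X)"
    and iii: "\<And>i j. i < j \<Longrightarrow> j < n \<Longrightarrow>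
      ((a i = 1 \<and> b j = X \<or> a i = X \<and> b j = 1) \<longrightarrow> a j = 1 \<and> b i = X) \<and> \<not> (a j = X \<and> b i = 1)"
    and iv_v: "\<And>i j e. i < j \<Longrightarrow> j < n \<Longrightarrow> e \<in> {1, X} \<Longrightarrow>
      (a i, a j, b i, b j) \<notin> {(0, e, e, 0), (0, e, e, e), (e, e, e, 0)}"
  shows "(\<Sum>i<n. a i * f i) \<lless> (\<Sum>i<n. b i * f i)"
proof -
  \<comment> \<open>Label 0 collects the columns \<open>(1, 1)\<close> and \<open>(X, X)\<close>,
    label 1 the columns \<open>(1, X)\<close>. As \<open>(X, 1)\<close> is excluded, label 2 is left
    with columns containing a zero.\<close>
  define c :: "nat \<Rightarrow> nat" where
    "c i = (if a i = b i \<and> a i \<noteq> 0 then 0 else if a i = 1 \<and> b i = X then 1 else 2)" for i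
  have le: "f i \<lless> f j" if "i \<le> j" "j < n" for i j
    using that il nn rr interlaces_refl by (cases "i = j") auto
  have real_rooted_row: "real_rooted (\<Sum>i\<in>I. w i * f i)" if "I \<subseteq> {..<n}" "w = a \<or> w = b" for I w
  proof (rule real_rooted_row_sum)
    show "finite I" using that(1) finite_subset by blast
    fix i assume "i \<in> I"
    then have "i < n" using that(1) by auto
    then show "nonneg_coeffs (f i)" "real_rooted (f i)" "w i \<in> {0, 1, X}"
      using nn rr a b that(2) by blast+
    fix j assume "j \<in> I" "i < j"
    then have "j < n" using that(1) by auto
    then show "f i \<lless> f j" "\<not> (w i = 1 \<and> w j = X)"
      using \<open>i < j\<close> il[of i j] ii[of i j] that(2) by auto
  qed
  have pair: "a i * f i \<lless> b j * f j" if ij: "i < n" "j < n" and c: "\<not> (c i = c j \<and> c i \<noteq> 2)" for i j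
  proof -
    have rrX: "real_rooted (w * f k) \<and> (w * f k \<noteq> 0 \<longrightarrow> lead_coeff (w * f k) > 0)"
      if "k < n" "w \<in> {0, 1, X}" for k w
    proof
      show "real_rooted (w * f k)"
        using that(2) rr[OF that(1)] real_rooted_X_mult[of "f k"] by (auto simp del: mult_pCons_left)
      show "w * f k \<noteq> 0 \<longrightarrow> lead_coeff (w * f k) > 0"
        using nonneg_coeffs_entry_mult[OF that(2) nn[OF that(1)]] nonneg_coeffs_lead_coeff by blast
    qed
    \<comment> \<open>Nonzero equal entries require \<open>i \<le> j\<close>, entries
      \<open>1\<close> and \<open>X\<close> require \<open>j \<le> i\<close> (via
      \<open>f i \<lless> X * f j\<close>), and \<open>X\<close> over \<open>1\<close> cannot
      occur.\<close>
    consider "a i = 0 \<or> b j = 0" | "a i = b j" "a i \<noteq> 0" | "a i = 1" "b j = X" | "a i = X" "b j = 1"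
      using a[OF ij(1)] b[OF ij(2)] by fastforce
    then show ?thesis
    proof cases
      case 1
      then show ?thesis
        using rrX[OF ij(2) b[OF ij(2)]] rrX[OF ij(1) a[OF ij(1)]]
        by (auto simp: interlaces_0_left interlaces_0_right simp del: mult_pCons_left)
    next
      case 2
      have "i \<le> j"
      proof (rule ccontr)
        assume "\<not> i \<le> j"
        then have ji: "j < i" by simp
        \<comment> \<open>The columns \<open>j < i\<close> carry equal entries on the antidiagonal.
          Every choice of the diagonal entries is excluded, unless all four entries agree, and then
          both columns have label 0.\<close>
        show False
          using iv_v[OF ji ij(1), of "a i"] i[OF ij(1)] i[OF ij(2)] ii[OF ji ij(1)] iii[OF ji ij(1)]
            a[OF ij(1)] a[OF ij(2)] b[OF ij(1)] b[OF ij(2)] c 2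
          unfolding c_def by (auto split: if_splits)
      qed
      then show ?thesis
        using 2 a[OF ij(1)] le[OF _ ij(2)] X_mult_interlaces_X_mult[OF nn[OF ij(1)] nn[OF ij(2)]] by auto
    next
      case 3
      have "j \<le> i"
      proof (rule ccontr)
        assume "\<not> j \<le> i"
        then have "i < j" by simp
        then show False
          using iii[OF _ ij(2), of i] 3 c unfolding c_def by auto
      qed
      then show ?thesis
        using 3 le[OF _ ij(1)] interlaces_X_mult_iff[OF nn[OF ij(2)] nn[OF ij(1)]] by simp
    next
      case 4
      consider "i < j" | "i = j" | "j < i" by linarith
      then have False
      proof cases
        case 1
        then show False using iii[OF 1 ij(2)] 4 c unfolding c_def by auto
      next
        case 2
        then show False using i ij 4 by auto
      next
        case 3
        then show False using iii[OF 3 ij(1)] 4 by auto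
      qed
      then show ?thesis ..
    qed
  qed
  define U where "U k = (\<Sum>i \<in> {i \<in> {..<n}. c i = k}. a i * f i)" for k
  define V where "V k = (\<Sum>i \<in> {i \<in> {..<n}. c i = k}. b i * f i)" for k
  have rrUV: "real_rooted (U k)" "real_rooted (V k)" for k
    unfolding U_def V_def by (intro real_rooted_row; auto)+
  have nnUV: "nonneg_coeffs (U k)" "nonneg_coeffs (V k)" for k
    unfolding U_def V_def using a b nn by (intro nonneg_coeffs_sum nonneg_coeffs_entry_mult; auto)+
  have group: "(\<Sum>k\<in>{0, 1, 2}. \<Sum>i \<in> {i \<in> {..<n}. c i = k}. h i) = (\<Sum>i<n. h i)" for h :: "nat \<Rightarrow> real poly"
    by (rule sum.group) (auto simp: c_def)
  have "U k \<lless> V l" for k l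
  proof -
    consider "k = 0" "l = 0" | "k = 1" "l = 1" | "\<not> (k = l \<and> k \<noteq> 2)" | "k = l" "k > 2"
      by linarith
    then show ?thesis
    proof cases
      case 1
      have "V 0 = U 0"
        unfolding U_def V_def by (intro sum.cong) (auto simp: c_def split: if_splits)
      then show ?thesis using 1 interlaces_refl[OF rrUV(1) nnUV(1)] by simp
    next
      case 2
      have "V 1 = X * U 1"
        unfolding U_def V_def sum_distrib_left
        by (intro sum.cong) (auto simp: c_def split: if_splits)
      then show ?thesis
        using 2 interlaces_refl[OF rrUV(1) nnUV(1)] interlaces_X_mult_iff[OF nnUV(1) nnUV(1)] by simp
    next
      case 3
      show ?thesis
        unfolding U_def V_def
      proof (rule interlaces_sum)
        show "real_rooted (\<Sum>i \<in> {i \<in> {..<n}. c i = k}. a i * f i)"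
          "real_rooted (\<Sum>i \<in> {i \<in> {..<n}. c i = l}. b i * f i)"
          using rrUV(1)[of k] rrUV(2)[of l] unfolding U_def V_def .
        show "nonneg_coeffs (a i * f i)" if "i \<in> {i \<in> {..<n}. c i = k}" for i
          using that nonneg_coeffs_entry_mult[OF a nn] by blast
        show "nonneg_coeffs (b i * f i)" if "i \<in> {i \<in> {..<n}. c i = l}" for i
          using that nonneg_coeffs_entry_mult[OF b nn] by blast
        show "a i * f i \<lless> b j * f j"
          if "i \<in> {i \<in> {..<n}. c i = k}" "j \<in> {i \<in> {..<n}. c i = l}" for i j
          using that 3 by (intro pair) auto
      qed simp_all
    \<comment> \<open>Labels above 2 do not occur; the case only completes the claim for all
      \<open>k\<close> and \<open>l\<close>.\<close>
    next
      case 4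
      then have empty: "{i \<in> {..<n}. c i = k} = {}"
        by (auto simp: c_def)
      show ?thesis
        unfolding U_def V_def 4(1)[symmetric] empty by (simp add: interlaces_0_left)
    qed
  qed
  moreover have "(\<Sum>k\<in>{0, 1, 2}. U k) = (\<Sum>i<n. a i * f i)" "(\<Sum>k\<in>{0, 1, 2}. V k) = (\<Sum>i<n. b i * f i)"
    unfolding U_def V_def by (rule group)+
  ultimately show ?thesis
    using interlaces_sum[of "{0, 1, 2}" "{0, 1, 2}" U V] nnUV
      real_rooted_row[OF order_refl, of a] real_rooted_row[OF order_refl, of b] by simp
qed

section \<open>Forbidden submatrices\<close>

lemma X_neq_1: "X \<noteq> 1"
  by (simp add: one_pCons)

lemma det_mat_of_rows_list_2:
  fixes a b c d :: "'a :: comm_ring_1"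
  shows "det (mat_of_rows_list 2 [[a, b], [c, d]]) = a * d - b * c"
proof -
  let ?A = "mat_of_rows_list 2 [[a, b], [c, d]]"
  have dim: "?A \<in> carrier_mat 2 2"
    by (simp add: mat_of_rows_list_def numeral_2_eq_2)
  have "det ?A = (\<Sum>j<2. ?A $$ (0, j) * cofactor ?A 0 j)"
    using laplace_expansion_row[OF dim] by simp
  also have "\<dots> = a * d - b * c"
    by (simp add: numeral_2_eq_2 cofactor_def mat_of_rows_list_def mat_delete_def det_single)
  finally show ?thesis .
qed

lemma submatrix2_index:
  "submatrix2 G k l i j $$ (0, 0) = G $$ (k, i)" "submatrix2 G k l i j $$ (0, 1) = G $$ (k, j)"
  "submatrix2 G k l i j $$ (1, 0) = G $$ (l, i)" "submatrix2 G k l i j $$ (1, 1) = G $$ (l, j)"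
  by (simp_all add: submatrix2_def mat_of_rows_list_def)

lemma mat_of_rows_list_2_eq_iff:
  "mat_of_rows_list 2 [[a, b], [c, d]] = mat_of_rows_list 2 [[a', b'], [c', d']] \<longleftrightarrow>
    a = a' \<and> b = b' \<and> c = c' \<and> d = d'"
  by (auto simp: mat_of_rows_list_def mat_eq_iff numeral_2_eq_2 less_Suc_eq)

text \<open>For zero-one entries \<open>a * d - b * c\<close> is negative iff
  \<open>b = c = 1\<close> and \<open>a * d = 0\<close>, so these are all such matrices.\<close>

lemma zero_one_neg_det_2:
  assumes "(a, b, c, d) \<in> {(0, 1, 1, 0), (0, 1, 1, 1), (1, 1, 1, 0)}"
  shows "zero_one_neg_det (mat_of_rows_list 2 [[a, b], [c, d]])"
  unfolding zero_one_neg_det_def det_mat_of_rows_list_2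
  using assms by (auto simp: mat_of_rows_list_def elements_mat_def numeral_2_eq_2 less_Suc_eq)

text \<open>Treats (iv) and (v) together as \<open>e\<close> times a zero-one matrix, with
  \<open>e = 1\<close> and \<open>e = X\<close> respectively.\<close>

lemma forbidden_iv_v_submatrix2:
  assumes e: "e \<in> {1, X}"
    and M: "(G $$ (k, i), G $$ (k, j), G $$ (l, i), G $$ (l, j)) \<in> {(0, e, e, 0), (0, e, e, e), (e, e, e, 0)}"
  shows "forbidden (submatrix2 G k l i j)"
proof -
  obtain a b c d :: real where abcd: "(a, b, c, d) \<in> {(0, 1, 1, 0), (0, 1, 1, 1), (1, 1, 1, 0)}"
    and G: "G $$ (k, i) = smult a e" "G $$ (k, j) = smult b e" "G $$ (l, i) = smult c e" "G $$ (l, j) = smult d e"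
    using M by fastforce
  let ?B = "mat_of_rows_list 2 [[a, b], [c, d]]"
  have "submatrix2 G k l i j = e \<cdot>\<^sub>m map_mat (\<lambda>c. [:c:]) ?B"
    unfolding submatrix2_def G by (rule eq_matI) (auto simp: mat_of_rows_list_def numeral_2_eq_2 less_Suc_eq)
  moreover have "1 \<cdot>\<^sub>m map_mat (\<lambda>c. [:c:]) ?B = map_mat (\<lambda>c. [:c:]) ?B"
    by (rule eq_matI) auto
  ultimately have "forbidden_iv (submatrix2 G k l i j) \<or> forbidden_v (submatrix2 G k l i j)"
    unfolding forbidden_iv_def forbidden_v_def using e zero_one_neg_det_2[OF abcd] by auto
  then show ?thesis
    unfolding forbidden_def by blast
qed

text \<open>The condition \<open>size\<close> rules out a single row or column with several entries:
  there the submatrix conditions are vacuous, yet the column \<open>(X, 1)\<close> sends the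
  constant 1 to a pair that does not interlace.\<close>

theorem theorem3p4:
  fixes G :: "real poly mat" and m n :: nat
  assumes G: "G \<in> carrier_mat m n"
    and size: "m = 1 \<longleftrightarrow> n = 1"
    and entries: "\<And>i j. i < m \<Longrightarrow> j < n \<Longrightarrow> G $$ (i, j) \<in> {0, 1, X}"
    and no_forbidden: "\<And>k l i j. k < l \<Longrightarrow> l < m \<Longrightarrow> i < j \<Longrightarrow> j < n \<Longrightarrow>
                         \<not> forbidden (submatrix2 G k l i j)"
  shows "\<forall>f \<in> F_plus n. G *\<^sub>v f \<in> F_plus m"
proof
  fix f assume f: "f \<in> F_plus n"
  then have nn: "nonneg_coeffs (f $ i)" and rr: "real_rooted (f $ i)" if "i < n" for i
    using that unfolding F_plus_def interlacing_sequence_def nonneg_coeffs_def by auto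
  have il: "f $ i \<lless> f $ j" if "i < j" "j < n" for i j
    using f that unfolding F_plus_def interlacing_sequence_def by auto
  have "f \<in> carrier_vec n"
    using f unfolding F_plus_def by auto
  then have dim: "dim_vec f = n" and carrier: "G *\<^sub>v f \<in> carrier_vec m"
    using G by auto
  have row: "(G *\<^sub>v f) $ k = (\<Sum>i<n. G $$ (k, i) * f $ i)" if "k < m" for k
    using that G dim by (simp add: scalar_prod_def atLeast0LessThan)
  have allowed: "\<not> forbidden_i (submatrix2 G k l i j)" "\<not> forbidden_ii (submatrix2 G k l i j)"
    "\<not> forbidden_iii (submatrix2 G k l i j)" if "k < l" "l < m" "i < j" "j < n" for k l i j
    using no_forbidden[OF that] unfolding forbidden_def by blast+
  have interlace: "(G *\<^sub>v f) $ k \<lless> (G *\<^sub>v f) $ l" if kl: "k < l" "l < m" for k l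
  proof -
    have k: "k < m" using kl by simp
    have "n \<noteq> 1" using size kl by auto
    show ?thesis
      unfolding row[OF k] row[OF kl(2)]
    proof (rule two_rows_interlace)
      show "\<not> (G $$ (k, i) = X \<and> G $$ (l, i) = 1)" if "i < n" for i
      \<comment> \<open>Excluding the column \<open>(X, 1)\<close> takes a second column to form a
        submatrix: column 1 if \<open>i = 0\<close>, otherwise column 0.\<close>
      proof (cases "i = 0")
        case True
        then have "i < 1" "1 < n" using that \<open>n \<noteq> 1\<close> by auto
        from allowed(1)[OF kl this] show ?thesis
          unfolding forbidden_i_def submatrix2_index by blast
      next
        case False
        then have "0 < i" by simp
        from allowed(1)[OF kl this that] show ?thesis
          unfolding forbidden_i_def submatrix2_index by blast
      qed
    next
      fix i j assume ij: "i < j" "j < n"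
      show "\<not> (G $$ (k, i) = 1 \<and> G $$ (k, j) = X) \<and> \<not> (G $$ (l, i) = 1 \<and> G $$ (l, j) = X)"
        using allowed(2)[OF kl ij] unfolding forbidden_ii_def submatrix2_index by blast
      \<comment> \<open>Both exceptions in (iii) have \<open>1\<close> in the upper right and
        \<open>X\<close> in the lower left corner and differ in the diagonal, hence the common
        conclusion.\<close>
      show "(G $$ (k, i) = 1 \<and> G $$ (l, j) = X \<or> G $$ (k, i) = X \<and> G $$ (l, j) = 1 \<longrightarrow>
          G $$ (k, j) = 1 \<and> G $$ (l, i) = X) \<and> \<not> (G $$ (k, j) = X \<and> G $$ (l, i) = 1)"
        using allowed(3)[OF kl ij] unfolding forbidden_iii_def submatrix2_index
        unfolding submatrix2_def mat_of_rows_list_2_eq_iff using X_neq_1 by auto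
      show "(G $$ (k, i), G $$ (k, j), G $$ (l, i), G $$ (l, j)) \<notin> {(0, e, e, 0), (0, e, e, e), (e, e, e, 0)}"
        if "e \<in> {1, X}" for e
        using forbidden_iv_v_submatrix2[OF that] no_forbidden[OF kl ij] by blast
    qed (use nn rr il entries kl k in blast)+
  qed
  have "real_rooted ((G *\<^sub>v f) $ k)" if k: "k < m" for k
  proof (cases "m = 1")
    case True
    then have "n = 1" "k = 0" using size k by auto
    then show ?thesis
      unfolding row[OF k] using nn rr entries[OF k]
      by (intro real_rooted_row_sum) auto
  next
    case False
    \<comment> \<open>Row 0 is compared with row 1 and every other row with row 0; interlacing
      includes real-rootedness.\<close>
    then consider "k < 1" "1 < m" | "0 < k" using k by linarith
    then show ?thesis
      using interlace interlaces_real_rooted k by cases blast+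
  qed
  moreover have "nonneg_coeffs ((G *\<^sub>v f) $ k)" if "k < m" for k
    unfolding row[OF that] using nn entries[OF that]
    by (intro nonneg_coeffs_sum nonneg_coeffs_entry_mult) auto
  ultimately show "G *\<^sub>v f \<in> F_plus m"
    using G carrier interlace unfolding F_plus_def interlacing_sequence_def nonneg_coeffs_def
    by (auto simp del: index_mult_mat_vec)
qed

end
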